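(* Let $n$ be a positive integer and $\alpha$ a real number with $n+\alpha>0$ and $n+2\alpha>0$. Let $x_1<x_2<\cdots$ be the consecutive zeros of the ultraspherical polynomial $P_n^{(\alpha,\alpha)}$ in $(-1,1)$, let $\Delta x_k=x_{k+1}-x_k$, and put $$F(t)=\frac{-(\alpha+n)(\alpha+n+1)t^2+(1+n+n^2+\alpha+2\alpha n)}{(t^2-1)^2}.$$ If $|\alpha|>1$ and $(n+\alpha)(n+\alpha+1)\le 2(\alpha^2-1)$, then the zeros of $P_n^{(\alpha,\alpha)}$ on $(-1,0)$ are concave and those on $(0,1)$ are convex. Furthermore, for all pairs of consecutive zeros $x_k,x_{k+1}$ in $(-1,1)$, $$\Delta x_k>\frac{\pi}{\sqrt{F(0)}}.$$
   Context: $P_n^{(\alpha,\alpha)}$ is the Jacobi polynomial with equal parameters (ultraspherical polynomial), defined for all real $\alpha$ by $$P_n^{(\alpha,\alpha)}(t)=\sum_{s=0}^{n}\binom{n+\alpha}{n-s}\binom{n+\alpha}{s}\left(\frac{t-1}{2}\right)^{s}\left(\frac{t+1}{2}\right)^{n-s};$$ it satisfies $(1-t^2)x''-(2\alpha+2)t\,x'+n(n+2\alpha+1)x=0$. Convexity convention: the zeros of a function on an interval $(a,b)$, listed in increasing order (only those lying in $(a,b)$), are called convex on $(a,b)$ if $x_{k+2}-x_{k+1}>x_{k+1}-x_k$ for every three consecutive zeros $x_k<x_{k+1}<x_{k+2}$ in $(a,b)$, and concave on $(a,b)$ if $x_{k+2}-x_{k+1}<x_{k+1}-x_k$ for every three consecutive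 zeros in $(a,b)$. *)

theory Defs
  imports Complex_Main
begin

definition ultraspherical :: "nat \<Rightarrow> real \<Rightarrow> real \<Rightarrow> real" where
  "ultraspherical n \<alpha> t =
     (\<Sum>s=0..n. ((real n + \<alpha>) gchoose (n - s)) * ((real n + \<alpha>) gchoose s)
        * ((t - 1) / 2) ^ s * ((t + 1) / 2) ^ (n - s))"

definition consecutive_zeros ::
    "(real \<Rightarrow> real) \<Rightarrow> real set \<Rightarrow> real \<Rightarrow> real \<Rightarrow> bool" where
  "consecutive_zeros f I x y \<longleftrightarrow>
     x \<in> I \<and> y \<in> I \<and> f x = 0 \<and> f y = 0 \<and> x < y \<and> (\<forall>z. x < z \<and> z < y \<longrightarrow> f z \<noteq> 0)"

definition convex_zeros_on :: "(real \<Rightarrow> real) \<Rightarrow> real set \<Rightarrow> bool" where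
  "convex_zeros_on f I \<longleftrightarrow>
     (\<forall>x y z. consecutive_zeros f I x y \<and> consecutive_zeros f I y z \<longrightarrow> z - y > y - x)"

definition concave_zeros_on :: "(real \<Rightarrow> real) \<Rightarrow> real set \<Rightarrow> bool" where
  "concave_zeros_on f I \<longleftrightarrow>
     (\<forall>x y z. consecutive_zeros f I x y \<and> consecutive_zeros f I y z \<longrightarrow> z - y < y - x)"

(* With A = (\<alpha> + n) (\<alpha> + n + 1), this is A / (1 - t^2) - (\<alpha>^2 - 1) / (1 - t^2)^2: the
   coefficient in the normal form u'' + F u = 0 of the ultraspherical differential equation,
   where u(t) = (1 - t^2) powr ((\<alpha> + 1) / 2) * ultraspherical n \<alpha> t. *)
definition ultraspherical_F :: "nat \<Rightarrow> real \<Rightarrow> real \<Rightarrow> real" where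
  "ultraspherical_F n \<alpha> t =
     (- (\<alpha> + real n) * (\<alpha> + real n + 1) * t ^ 2
        + (1 + real n + real n ^ 2 + \<alpha> + 2 * \<alpha> * real n)) / (t ^ 2 - 1) ^ 2"

end

theory Submission
  imports Defs
begin

text \<open>
  Multiplying the ultraspherical polynomial by \<open>(1 - t\<^sup>2) powr ((\<alpha> + 1) / 2)\<close>, which is
  positive on \<open>(-1, 1)\<close>, does not move its zeros there and turns its differential equation into
  \<open>u'' + F u = 0\<close> (lemma \<open>ultraspherical_normal_form\<close>). The spacing of the zeros of such a
  solution is governed by the monotonicity of \<open>F\<close>: where \<open>F\<close> is larger, \<open>u\<close> oscillates faster.

  With \<open>w = 1 / (1 - t\<^sup>2)\<close>, the coefficient is the quadratic \<open>A w - B w\<^sup>2\<close>, where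
  \<open>A = (n + \<alpha>) (n + \<alpha> + 1)\<close> and \<open>B = \<alpha>\<^sup>2 - 1\<close>. As \<open>t\<close> runs through \<open>(-1, 1)\<close>,
  \<open>w\<close> runs through \<open>[1, \<infinity>)\<close>, and the hypotheses \<open>B > 0\<close> and \<open>A \<le> 2 B\<close> say exactly that the
  parabola opens downwards with its vertex at some \<open>w \<le> 1\<close>. Hence \<open>F\<close> is strictly decreasing
  in \<open>\<bar>t\<bar>\<close> (lemma \<open>ultraspherical_F_decreasing\<close>).

  Everything else is the Sturm comparison theorem, applied to \<open>u\<close> and a second function. Reflecting
  \<open>u\<close> about the middle one of three consecutive zeros compares the two gaps on its sides; this gives
  convexity on \<open>(0, 1)\<close>, and after \<open>t \<mapsto> -t\<close> concavity on \<open>(-1, 0)\<close>. Since \<open>F < F 0\<close> off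
  the origin, comparison with a sine of frequency \<open>sqrt (F 0)\<close> bounds every gap from below.

  The differential equation for arbitrary real \<open>\<alpha>\<close> comes straight from the defining sum: the
  differential operator sends each summand to a combination of two monomials of degree \<open>n - 1\<close>, and
  the binomial coefficients are such that the sum telescopes (lemma \<open>ultraspherical_ode\<close>).
\<close>

section \<open>Sturm comparison\<close>

text \<open>
  The Wronskian \<open>u' v - u v'\<close> has derivative \<open>(G - F) u v \<ge> 0\<close>. It starts at \<open>0\<close> because both
  functions vanish at \<open>a\<close>, and it ends at \<open>u' b * v b \<le> 0\<close> because \<open>u\<close> descends to its zero
  at \<open>b\<close>. So it is constant, and its derivative vanishes. Concluding \<open>F = G\<close> rather than a
  contradiction accommodates coefficients that touch at isolated points.
\<close>

lemma sturm_comparison_pos: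
  fixes u u' v v' F G :: "real \<Rightarrow> real"
  assumes "a < b"
    and du: "\<And>t. t \<in> {a..b} \<Longrightarrow> (u has_real_derivative u' t) (at t)"
    and ddu: "\<And>t. t \<in> {a..b} \<Longrightarrow> (u' has_real_derivative - F t * u t) (at t)"
    and dv: "\<And>t. t \<in> {a..b} \<Longrightarrow> (v has_real_derivative v' t) (at t)"
    and ddv: "\<And>t. t \<in> {a..b} \<Longrightarrow> (v' has_real_derivative - G t * v t) (at t)"
    and ends: "u a = 0" "u b = 0" "v a = 0"
    and pos: "\<And>t. t \<in> {a<..<b} \<Longrightarrow> 0 < u t" "\<And>t. t \<in> {a<..<b} \<Longrightarrow> 0 < v t"
    and le: "\<And>t. t \<in> {a<..<b} \<Longrightarrow> F t \<le> G t"
    and t: "t \<in> {a<..<b}"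
  shows "F t = G t"
proof -
  define W where "W = (\<lambda>t. u' t * v t - u t * v' t)"
  have dW: "(W has_real_derivative (G t - F t) * (u t * v t)) (at t)" if "t \<in> {a..b}" for t
    unfolding W_def
    by (auto intro!: derivative_eq_intros du[OF that] ddu[OF that] dv[OF that] ddv[OF that]
        simp: algebra_simps)
  have nonneg: "0 \<le> (G t - F t) * (u t * v t)" if "t \<in> {a..b}" for t
  proof (cases "t \<in> {a<..<b}")
    case True
    then show ?thesis using pos[of t] le[of t] by simp
  next
    case False
    then have "t = a \<or> t = b" using that by auto
    then show ?thesis using ends by auto
  qed
  have mono: "W x \<le> W y" if "a \<le> x" "x \<le> y" "y \<le> b" for x y
    using that by (intro DERIV_nonneg_imp_nondecreasing[of x y W]) (auto intro!: exI dW nonneg)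
  have "u' b \<le> 0"
  proof (rule ccontr)
    assume "\<not> u' b \<le> 0"
    then obtain d where d: "d > 0" "\<And>h. 0 < h \<Longrightarrow> h < d \<Longrightarrow> u (b - h) < u b"
      using DERIV_pos_inc_left[OF du[of b]] \<open>a < b\<close> by auto
    obtain h where "0 < h" "h < d" "h < b - a"
      using dense[of 0 "min d (b - a)"] d(1) \<open>a < b\<close> by auto
    then show False using d(2)[of h] pos(1)[of "b - h"] ends by simp
  qed
  moreover have "0 \<le> v b"
  proof (rule tendsto_lowerbound)
    have "(v \<longlongrightarrow> v b) (at b)"
      using DERIV_isCont[OF dv[of b]] \<open>a < b\<close> by (simp add: isCont_def)
    then show "(v \<longlongrightarrow> v b) (at_left b)"
      by (rule tendsto_mono[rotated]) (simp add: at_le)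
    show "\<forall>\<^sub>F s in at_left b. 0 \<le> v s"
      unfolding eventually_at_left[OF \<open>a < b\<close>] using \<open>a < b\<close> pos(2)
      by (auto intro!: bexI[of _ a] less_imp_le)
  qed simp
  ultimately have "W b \<le> 0"
    using ends by (simp add: W_def mult_nonpos_nonneg)
  moreover have "W a = 0" using ends by (simp add: W_def)
  ultimately have W0: "W s = 0" if "s \<in> {a..b}" for s
    using mono[of a s] mono[of s b] that by auto
  have "(G t - F t) * (u t * v t) = 0"
  proof (rule DERIV_local_const)
    show "(W has_real_derivative (G t - F t) * (u t * v t)) (at t)" using t by (intro dW) auto
    show "0 < min (t - a) (b - t)" using t by simp
    show "\<forall>s. \<bar>t - s\<bar> < min (t - a) (b - t) \<longrightarrow> W t = W s"
      using t by (auto simp: W0 abs_if split: if_splits)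
  qed
  then show ?thesis using pos[OF t] by simp
qed

text \<open>
  The scaling factor makes it possible to assume positivity in a linear differential equation
  without a case distinction on signs.
\<close>

lemma nonvanishing_constant_sign:
  fixes f :: "real \<Rightarrow> real"
  assumes cont: "\<And>t. t \<in> {a<..<b} \<Longrightarrow> isCont f t"
    and nz: "\<And>t. t \<in> {a<..<b} \<Longrightarrow> f t \<noteq> 0"
  obtains c where "c \<noteq> 0" "\<And>t. t \<in> {a<..<b} \<Longrightarrow> 0 < c * f t"
proof (cases "a < b")
  case True
  define m where "m = (a + b) / 2"
  have m: "m \<in> {a<..<b}" using True by (simp add: m_def)
  have pos: "0 < f m * f t" if t: "t \<in> {a<..<b}" for t
  proof (rule ccontr)
    assume neg: "\<not> 0 < f m * f t"
    have "\<exists>s. min m t \<le> s \<and> s \<le> max m t \<and> f m * f s = 0"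
    proof (cases "m \<le> t")
      case True
      have "\<exists>s. m \<le> s \<and> s \<le> t \<and> f m * f s = 0"
        using neg True m t cont
        by (intro IVT2[of "\<lambda>s. f m * f s"]) (auto intro!: continuous_intros)
      then show ?thesis using True by auto
    next
      case False
      have "\<exists>s. t \<le> s \<and> s \<le> m \<and> f m * f s = 0"
        using neg False m t cont
        by (intro IVT[of "\<lambda>s. f m * f s"]) (auto intro!: continuous_intros)
      then show ?thesis using False by auto
    qed
    then obtain s where "min m t \<le> s" "s \<le> max m t" "f m * f s = 0" by blast
    then show False using nz[of s] nz[OF m] m t by (auto simp: min_def max_def split: if_splits)
  qed
  show ?thesis by (rule that[of "f m"]) (use nz[OF m] pos in auto)
next
  case False
  then show ?thesis by (intro that[of 1]) auto
qed

lemma sturm_comparison: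
  fixes u u' v v' F G :: "real \<Rightarrow> real"
  assumes "a < b"
    and du: "\<And>t. t \<in> {a..b} \<Longrightarrow> (u has_real_derivative u' t) (at t)"
    and ddu: "\<And>t. t \<in> {a..b} \<Longrightarrow> (u' has_real_derivative - F t * u t) (at t)"
    and dv: "\<And>t. t \<in> {a..b} \<Longrightarrow> (v has_real_derivative v' t) (at t)"
    and ddv: "\<And>t. t \<in> {a..b} \<Longrightarrow> (v' has_real_derivative - G t * v t) (at t)"
    and ends: "u a = 0" "u b = 0" "v a = 0"
    and nz: "\<And>t. t \<in> {a<..<b} \<Longrightarrow> u t \<noteq> 0" "\<And>t. t \<in> {a<..<b} \<Longrightarrow> v t \<noteq> 0"
    and le: "\<And>t. t \<in> {a<..<b} \<Longrightarrow> F t \<le> G t"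
    and t: "t \<in> {a<..<b}"
  shows "F t = G t"
proof -
  obtain c where c: "c \<noteq> 0" "\<And>t. t \<in> {a<..<b} \<Longrightarrow> 0 < c * u t"
    using nonvanishing_constant_sign[of a b u] nz(1) DERIV_isCont[OF du]
    by (metis atLeastAtMost_iff greaterThanLessThan_iff less_imp_le)
  obtain d where d: "d \<noteq> 0" "\<And>t. t \<in> {a<..<b} \<Longrightarrow> 0 < d * v t"
    using nonvanishing_constant_sign[of a b v] nz(2) DERIV_isCont[OF dv]
    by (metis atLeastAtMost_iff greaterThanLessThan_iff less_imp_le)
  show ?thesis
  proof (rule sturm_comparison_pos[where u = "\<lambda>t. c * u t" and u' = "\<lambda>t. c * u' t"
        and v = "\<lambda>t. d * v t" and v' = "\<lambda>t. d * v' t" and a = a and b = b and F = F and G = G])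
    show "((\<lambda>t. c * u' t) has_real_derivative - F t * (c * u t)) (at t)" if "t \<in> {a..b}" for t
      using DERIV_cmult[OF ddu[OF that], of c] by (simp add: ac_simps)
    show "((\<lambda>t. d * v' t) has_real_derivative - G t * (d * v t)) (at t)" if "t \<in> {a..b}" for t
      using DERIV_cmult[OF ddv[OF that], of d] by (simp add: ac_simps)
  qed (use assms c d in \<open>auto intro!: DERIV_cmult\<close>)
qed

section \<open>Spacing of the zeros of a solution\<close>

text \<open>
  The reflection \<open>t \<mapsto> u (2 y - t)\<close> about the middle zero solves the equation with the reflected
  coefficient, which is the larger one to the right of \<open>y\<close>. If the right gap were not longer than
  the left one, the reflected solution would have no zero inside the right gap, against Sturm.
\<close>

lemma convex_zeros_if_coefficient_decreasing:
  fixes u u' F :: "real \<Rightarrow> real"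
  assumes du: "\<And>t. t \<in> {c<..<d} \<Longrightarrow> (u has_real_derivative u' t) (at t)"
    and ddu: "\<And>t. t \<in> {c<..<d} \<Longrightarrow> (u' has_real_derivative - F t * u t) (at t)"
    and dec: "\<And>s t. c < s \<Longrightarrow> s < t \<Longrightarrow> t < d \<Longrightarrow> F t < F s"
  shows "convex_zeros_on u {c<..<d}"
  unfolding convex_zeros_on_def
proof (intro allI impI, rule ccontr)
  fix x y z
  assume zeros: "consecutive_zeros u {c<..<d} x y \<and> consecutive_zeros u {c<..<d} y z"
    and "\<not> y - x < z - y"
  then have gap: "z - y \<le> y - x" by simp
  have order: "c < x" "x < y" "y < z" "z < d" and at_zeros: "u y = 0" "u z = 0"
    and nz: "\<And>t. x < t \<Longrightarrow> t < y \<Longrightarrow> u t \<noteq> 0" "\<And>t. y < t \<Longrightarrow> t < z \<Longrightarrow> u t \<noteq> 0"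
    using zeros by (auto simp: consecutive_zeros_def)
  define m where "m = (y + z) / 2"
  have m: "y < m" "m < z" using order by (auto simp: m_def)
  have "F m = F (2 * y - m)"
  proof (rule sturm_comparison[where u = u and u' = u' and a = y and b = z
        and v = "\<lambda>t. u (2 * y - t)" and v' = "\<lambda>t. - u' (2 * y - t)"
        and F = F and G = "\<lambda>t. F (2 * y - t)"])
    fix t assume "t \<in> {y..z}"
    then have t: "t \<in> {c<..<d}" "2 * y - t \<in> {c<..<d}" using order gap by auto
    show "(u has_real_derivative u' t) (at t)" by (rule du[OF t(1)])
    show "(u' has_real_derivative - F t * u t) (at t)" by (rule ddu[OF t(1)])
    have reflection: "((\<lambda>t. 2 * y - t) has_real_derivative - 1) (at t)"
      by (auto intro!: derivative_eq_intros)
    show "((\<lambda>t. u (2 * y - t)) has_real_derivative - u' (2 * y - t)) (at t)"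
      using DERIV_chain2[where f = u and g = "\<lambda>t. 2 * y - t", OF du[OF t(2)] reflection]
      by simp
    show "((\<lambda>t. - u' (2 * y - t)) has_real_derivative - F (2 * y - t) * u (2 * y - t)) (at t)"
      using DERIV_minus[OF DERIV_chain2[where f = u' and g = "\<lambda>t. 2 * y - t", OF ddu[OF t(2)] reflection]]
      by simp
  next
    fix t assume t: "t \<in> {y<..<z}"
    show "u t \<noteq> 0" using t nz(2) by auto
    show "u (2 * y - t) \<noteq> 0" using t nz(1)[of "2 * y - t"] gap order by auto
    show "F t \<le> F (2 * y - t)"
      using t gap order by (intro less_imp_le dec) auto
  qed (use order at_zeros m in auto)
  moreover have "F m < F (2 * y - m)" using m gap order by (intro dec) auto
  ultimately show False by simp
qed

lemma concave_zeros_if_reflection_convex: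
  assumes "convex_zeros_on (\<lambda>t. f (- t)) {-d<..<-c}"
  shows "concave_zeros_on f {c<..<d :: real}"
proof -
  have reflect: "consecutive_zeros (\<lambda>t. f (- t)) {-d<..<-c} (- y) (- x)"
    if "consecutive_zeros f {c<..<d} x y" for x y
    using that unfolding consecutive_zeros_def
    by (auto dest: spec[of _ "- _"] simp: less_minus_iff minus_less_iff)
  show ?thesis
    unfolding concave_zeros_on_def
  proof (intro allI impI)
    fix x y z
    assume "consecutive_zeros f {c<..<d} x y \<and> consecutive_zeros f {c<..<d} y z"
    then have "- x - - y > - y - - z"
      using assms reflect unfolding convex_zeros_on_def by blast
    then show "z - y < y - x" by simp
  qed
qed

lemma concave_zeros_if_coefficient_increasing:
  fixes u u' F :: "real \<Rightarrow> real"
  assumes du: "\<And>t. t \<in> {c<..<d} \<Longrightarrow> (u has_real_derivative u' t) (at t)"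
    and ddu: "\<And>t. t \<in> {c<..<d} \<Longrightarrow> (u' has_real_derivative - F t * u t) (at t)"
    and inc: "\<And>s t. c < s \<Longrightarrow> s < t \<Longrightarrow> t < d \<Longrightarrow> F s < F t"
  shows "concave_zeros_on u {c<..<d}"
proof (rule concave_zeros_if_reflection_convex,
    rule convex_zeros_if_coefficient_decreasing[where u' = "\<lambda>t. - u' (- t)" and F = "\<lambda>t. F (- t)"])
  fix t assume "t \<in> {-d<..<-c}"
  then have t: "- t \<in> {c<..<d}" by auto
  have reflection: "(uminus has_real_derivative - 1) (at t)"
    by (auto intro!: derivative_eq_intros)
  show "((\<lambda>t. u (- t)) has_real_derivative - u' (- t)) (at t)"
    using DERIV_chain2[where f = u and g = uminus, OF du[OF t] reflection]
      by simp
  show "((\<lambda>t. - u' (- t)) has_real_derivative - F (- t) * u (- t)) (at t)"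
    using DERIV_minus[OF DERIV_chain2[where f = u' and g = uminus, OF ddu[OF t] reflection]]
      by simp
qed (use inc in auto)

text \<open>
  The comparison function \<open>sin (sqrt M * (t - x))\<close> solves \<open>v'' + M v = 0\<close> and has no zero for
  a distance \<open>pi / sqrt M\<close> to the right of \<open>x\<close>. The bound on \<open>F\<close> may be attained, as long as
  it is not attained on a whole interval; the gap is still strictly longer.
\<close>

lemma gap_gt_if_coefficient_bounded:
  fixes u u' F :: "real \<Rightarrow> real"
  assumes du: "\<And>t. t \<in> {c<..<d} \<Longrightarrow> (u has_real_derivative u' t) (at t)"
    and ddu: "\<And>t. t \<in> {c<..<d} \<Longrightarrow> (u' has_real_derivative - F t * u t) (at t)"
    and bound: "\<And>t. t \<in> {c<..<d} \<Longrightarrow> F t \<le> M"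
    and strict: "\<And>a b. c < a \<Longrightarrow> a < b \<Longrightarrow> b < d \<Longrightarrow> \<exists>t\<in>{a<..<b}. F t < M"
    and "0 < M"
    and zeros: "consecutive_zeros u {c<..<d} x y"
  shows "y - x > pi / sqrt M"
proof (rule ccontr)
  define w where "w = sqrt M"
  have w: "0 < w" "w * w = M" using \<open>0 < M\<close> by (auto simp: w_def)
  assume "\<not> y - x > pi / sqrt M"
  then have gap: "w * (y - x) \<le> pi" using w by (simp add: w_def[symmetric] field_simps)
  have order: "c < x" "x < y" "y < d" and at_zeros: "u x = 0" "u y = 0"
    and nz: "\<And>t. x < t \<Longrightarrow> t < y \<Longrightarrow> u t \<noteq> 0"
    using zeros by (auto simp: consecutive_zeros_def)
  obtain m where m: "m \<in> {x<..<y}" "F m < M" using strict order by blast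
  have "F m = M"
  proof (rule sturm_comparison[where u = u and u' = u' and a = x and b = y
        and v = "\<lambda>t. sin (w * (t - x))" and v' = "\<lambda>t. w * cos (w * (t - x))"
        and F = F and G = "\<lambda>_. M"])
    fix t assume "t \<in> {x..y}"
    then have t: "t \<in> {c<..<d}" using order by auto
    show "(u has_real_derivative u' t) (at t)" by (rule du[OF t])
    show "(u' has_real_derivative - F t * u t) (at t)" by (rule ddu[OF t])
    show "((\<lambda>t. sin (w * (t - x))) has_real_derivative w * cos (w * (t - x))) (at t)"
      by (auto intro!: derivative_eq_intros)
    show "((\<lambda>t. w * cos (w * (t - x))) has_real_derivative - M * sin (w * (t - x))) (at t)"
      by (auto intro!: derivative_eq_intros simp: w(2)[symmetric])
  next
    fix t assume t: "t \<in> {x<..<y}"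
    have "0 < w * (t - x)" using t w by simp
    moreover have "w * (t - x) < w * (y - x)" using t w by simp
    ultimately have "0 < sin (w * (t - x))" using gap by (intro sin_gt_zero) auto
    then show "sin (w * (t - x)) \<noteq> 0" by simp
    show "u t \<noteq> 0" using t nz by auto
    show "F t \<le> M" using t order by (intro bound) auto
  qed (use order at_zeros m in auto)
  then show False using m by simp
qed

section \<open>The ultraspherical differential equation\<close>

text \<open>
  With \<open>p = (t - 1) / 2\<close> and \<open>q = (t + 1) / 2\<close> one has \<open>t = p + q\<close> and \<open>1 - t\<^sup>2 = - 4 p q\<close>, and
  the left-hand side is the ultraspherical operator of degree \<open>s + m\<close> applied to \<open>p\<^sup>s q\<^sup>m\<close>. The
  letters \<open>Ai\<close> and \<open>Bi\<close> stand for the \<open>i\<close>-th derivatives of \<open>p\<^sup>s\<close> and \<open>q\<^sup>m\<close> with respect to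
  \<open>p\<close> and \<open>q\<close>. Knowing them only through the Euler relations avoids case distinctions on small
  exponents. The result is a combination of \<open>p\<^sup>s q\<^bsup>m-1\<^esup>\<close> and \<open>p\<^bsup>s-1\<^esup> q\<^sup>m\<close> because
  multiplying the mixed derivative \<open>p\<^bsup>s-1\<^esup> q\<^bsup>m-1\<^esup>\<close> by \<open>q - p = 1\<close> raises its degree by one.
\<close>

lemma ultraspherical_operator_on_monomial:
  fixes p q \<alpha> s m A0 A1 A2 B0 B1 B2 :: real
  assumes "p * A1 = s * A0" "p * A2 = (s - 1) * A1" "q * B1 = m * B0" "q * B2 = (m - 1) * B1"
    and q: "q = p + 1"
  shows "- (p * q) * (A2 * B0 + 2 * (A1 * B1) + A0 * B2)
      - (\<alpha> + 1) * (p + q) * (A1 * B0 + A0 * B1) + (s + m) * (s + m + 2 * \<alpha> + 1) * (A0 * B0)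
    = (m + \<alpha>) * (A0 * B1) - (s + \<alpha>) * (A1 * B0)"
  using assms by algebra

text \<open>
  Applying the operator to the \<open>s\<close>-th summand yields \<open>X s - Y s\<close>, where \<open>X s\<close> and \<open>Y (s + 1)\<close>
  are multiples of the same monomial \<open>p\<^sup>s q\<^bsup>n-1-s\<^esup>\<close>. They coincide by
  \<open>(j + 1) (N gchoose (j + 1)) = (N - j) (N gchoose j)\<close>, used once for each of the two binomial
  coefficients, and the boundary terms \<open>X n\<close> and \<open>Y 0\<close> vanish.
\<close>

lemma ultraspherical_ode:
  obtains P' P'' where
    "\<And>t. (ultraspherical n \<alpha> has_real_derivative P' t) (at t)"
    "\<And>t. (P' has_real_derivative P'' t) (at t)"
    "\<And>t. (1 - t^2) * P'' t - (2 * \<alpha> + 2) * t * P' t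
        + real n * (real n + 2 * \<alpha> + 1) * ultraspherical n \<alpha> t = 0"
proof -
  define N where "N = real n + \<alpha>"
  define c where "c s = (N gchoose (n - s)) * (N gchoose s)" for s
  define D0 D1 D2 :: "nat \<Rightarrow> real \<Rightarrow> real" where
    "D0 s x = x ^ s" and "D1 s x = real s * x ^ (s - 1)"
    and "D2 s x = real s * (real s - 1) * x ^ (s - 2)" for s x
  define p q :: "real \<Rightarrow> real" where "p t = (t - 1) / 2" and "q t = (t + 1) / 2" for t
  define P' where "P' t = (\<Sum>s\<le>n. c s * ((D1 s (p t) * D0 (n - s) (q t)
      + D0 s (p t) * D1 (n - s) (q t)) / 2))" for t
  define P'' where "P'' t = (\<Sum>s\<le>n. c s * ((D2 s (p t) * D0 (n - s) (q t)
      + 2 * (D1 s (p t) * D1 (n - s) (q t)) + D0 s (p t) * D2 (n - s) (q t)) / 4))" for t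
  have P: "ultraspherical n \<alpha> = (\<lambda>t. \<Sum>s\<le>n. c s * (D0 s (p t) * D0 (n - s) (q t)))"
    by (rule ext) (simp add: ultraspherical_def c_def N_def D0_def p_def q_def atLeast0AtMost mult.assoc)
  have D0: "(D0 s has_real_derivative D1 s x) (at x)" for s x
    unfolding D0_def D1_def by (auto intro!: derivative_eq_intros)
  have D1: "(D1 s has_real_derivative D2 s x) (at x)" for s x
  proof (cases s)
    case (Suc k)
    then show ?thesis unfolding D1_def D2_def by (auto intro!: derivative_eq_intros simp: of_nat_diff)
  qed (simp add: D1_def[abs_def] D2_def)
  have dp: "(p has_real_derivative 1 / 2) (at t)" and dq: "(q has_real_derivative 1 / 2) (at t)" for t
    unfolding p_def q_def by (auto intro!: derivative_eq_intros)
  have Dp: "((\<lambda>t. D0 s (p t)) has_real_derivative D1 s (p t) * (1 / 2)) (at t)"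
    "((\<lambda>t. D1 s (p t)) has_real_derivative D2 s (p t) * (1 / 2)) (at t)" for s t
    by (rule DERIV_chain2[OF D0 dp] DERIV_chain2[OF D1 dp])+
  have Dq: "((\<lambda>t. D0 s (q t)) has_real_derivative D1 s (q t) * (1 / 2)) (at t)"
    "((\<lambda>t. D1 s (q t)) has_real_derivative D2 s (q t) * (1 / 2)) (at t)" for s t
    by (rule DERIV_chain2[OF D0 dq] DERIV_chain2[OF D1 dq])+
  have dP: "(ultraspherical n \<alpha> has_real_derivative P' t) (at t)" for t
    unfolding P P'_def
    by (auto intro!: derivative_eq_intros Dp Dq sum.cong simp: field_simps)
  have dP': "(P' has_real_derivative P'' t) (at t)" for t
    unfolding P'_def[abs_def] P''_def
    by (auto intro!: derivative_eq_intros Dp Dq sum.cong simp: field_simps)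
  have ode: "(1 - t^2) * P'' t - (2 * \<alpha> + 2) * t * P' t
      + real n * (real n + 2 * \<alpha> + 1) * ultraspherical n \<alpha> t = 0" for t
  proof -
    define X where "X s = c s * ((N - real s) * (D0 s (p t) * D1 (n - s) (q t)))" for s
    define Y where "Y s = c s * ((real s + \<alpha>) * (D1 s (p t) * D0 (n - s) (q t)))" for s
    have t: "t = p t + q t" "1 - t^2 = - (4 * (p t * q t))" "q t = p t + 1"
      by (simp_all add: p_def q_def field_simps power2_eq_square)
    have rel: "x * D1 s x = real s * D0 s x" "x * D2 s x = (real s - 1) * D1 s x" for s and x :: real
    proof -
      show "x * D1 s x = real s * D0 s x" by (cases s) (auto simp: D0_def D1_def)
      consider "s = 0" | "s = 1" | k where "s = Suc (Suc k)" by (metis One_nat_def not0_implies_Suc)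
      then show "x * D2 s x = (real s - 1) * D1 s x"
        by cases (auto simp: D1_def D2_def)
    qed
    have "(1 - t^2) * P'' t - (2 * \<alpha> + 2) * t * P' t
        + real n * (real n + 2 * \<alpha> + 1) * ultraspherical n \<alpha> t = (\<Sum>s\<le>n. X s - Y s)"
      unfolding P P'_def P''_def sum_distrib_left sum.distrib[symmetric] sum_subtractf[symmetric]
    proof (rule sum.cong[OF refl])
      fix s assume "s \<in> {..n}"
      then have n: "real n = real s + real (n - s)" by simp
      show "(1 - t\<^sup>2) * (c s * ((D2 s (p t) * D0 (n - s) (q t)
          + 2 * (D1 s (p t) * D1 (n - s) (q t)) + D0 s (p t) * D2 (n - s) (q t)) / 4))
        - (2 * \<alpha> + 2) * t * (c s * ((D1 s (p t) * D0 (n - s) (q t) + D0 s (p t) * D1 (n - s) (q t)) / 2))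
        + real n * (real n + 2 * \<alpha> + 1) * (c s * (D0 s (p t) * D0 (n - s) (q t))) = X s - Y s"
        (is "?L = _")
      proof -
        have "?L = c s * (- (p t * q t) * (D2 s (p t) * D0 (n - s) (q t)
            + 2 * (D1 s (p t) * D1 (n - s) (q t)) + D0 s (p t) * D2 (n - s) (q t))
          - (\<alpha> + 1) * (p t + q t) * (D1 s (p t) * D0 (n - s) (q t) + D0 s (p t) * D1 (n - s) (q t))
          + (real s + real (n - s)) * (real s + real (n - s) + 2 * \<alpha> + 1)
            * (D0 s (p t) * D0 (n - s) (q t)))"
          unfolding t(2) t(1)[symmetric] n[symmetric] by (simp add: field_simps)
        also have "\<dots> = X s - Y s"
          unfolding ultraspherical_operator_on_monomial[OF rel rel t(3)]
          by (simp add: X_def Y_def N_def n right_diff_distrib)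
        finally show ?thesis .
      qed
    qed
    also have "\<dots> = (\<Sum>s\<le>n. X s) - (\<Sum>s\<le>n. Y s)" by (rule sum_subtractf)
    also have "(\<Sum>s\<le>n. X s) = (\<Sum>s\<le>n. Y s)"
    proof (cases n)
      case 0
      then show ?thesis by (simp add: X_def Y_def D1_def)
    next
      case (Suc m)
      have "X s = Y (Suc s)" if "s \<le> m" for s
      proof -
        define k where "k = m - s"
        have k: "n - s = Suc k" "n - Suc s = k" "real m = real s + real k" "real n = real s + real k + 1"
          using that Suc by (auto simp: k_def)
        have lower: "real (Suc j) * (N gchoose Suc j) = (N - real j) * (N gchoose j)" for j
          using gbinomial_absorb_comp[of N j] gbinomial_absorption'[of "Suc j" N]
          by (simp add: gbinomial_absorption)
        have "X s = (N gchoose s) * (N - real s) * (real (Suc k) * (N gchoose Suc k)) * (p t ^ s * q t ^ k)"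
          by (simp add: X_def c_def k D0_def D1_def)
        also have "\<dots> = (real (Suc s) * (N gchoose Suc s)) * ((N - real k) * (N gchoose k)) * (p t ^ s * q t ^ k)"
          unfolding lower by simp
        also have "\<dots> = Y (Suc s)"
          by (simp add: Y_def c_def k D0_def D1_def N_def)
        finally show ?thesis .
      qed
      then have "(\<Sum>s\<le>m. X s) = (\<Sum>s\<le>m. Y (Suc s))" by simp
      moreover have "X n = 0" "Y 0 = 0" by (simp_all add: X_def Y_def D1_def)
      ultimately show ?thesis
        unfolding Suc by (subst (2) sum.atMost_Suc_shift) (simp add: Suc)
    qed
    finally show ?thesis by simp
  qed
  show ?thesis by (rule that[OF dP dP' ode])
qed

section \<open>The normal form\<close>

text \<open>The partial fractions exhibit the coefficient as a quadratic in \<open>1 / (1 - t\<^sup>2)\<close>.\<close>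

lemma ultraspherical_F_eq:
  assumes "t \<in> {-1<..<1}"
  shows "ultraspherical_F n \<alpha> t = (real n + \<alpha>) * (real n + \<alpha> + 1) / (1 - t^2)
    - (\<alpha>^2 - 1) / (1 - t^2)^2"
proof -
  have "t^2 < 1" using assms by (simp add: abs_square_less_1 abs_less_iff)
  then have "1 - t^2 \<noteq> 0" by simp
  have "ultraspherical_F n \<alpha> t
      = ((real n + \<alpha>) * (real n + \<alpha> + 1) * (1 - t^2) - (\<alpha>^2 - 1)) / (1 - t^2)^2"
    unfolding ultraspherical_F_def power2_commute[of "t^2"]
    by (rule arg_cong2[where f = "(/)"], algebra, rule refl)
  also have "\<dots> = (real n + \<alpha>) * (real n + \<alpha> + 1) / (1 - t^2) - (\<alpha>^2 - 1) / (1 - t^2)^2"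
    using \<open>1 - t^2 \<noteq> 0\<close> by (simp add: diff_divide_distrib power2_eq_square[of "1 - t^2"])
  finally show ?thesis .
qed

text \<open>
  The exponent \<open>(\<alpha> + 1) / 2\<close> is the one for which the first-order terms cancel: after
  division by \<open>1 - t\<^sup>2\<close> the first derivative has the coefficient \<open>- 2 h\<close> with
  \<open>h = (\<alpha> + 1) t / (1 - t\<^sup>2)\<close>, and the logarithmic derivative of the factor is \<open>- h\<close>.
\<close>

lemma ultraspherical_normal_form:
  fixes n :: nat and \<alpha> :: real
  defines "u \<equiv> \<lambda>t. (1 - t^2) powr ((\<alpha> + 1) / 2) * ultraspherical n \<alpha> t"
  obtains u' where
    "\<And>t. t \<in> {-1<..<1} \<Longrightarrow> (u has_real_derivative u' t) (at t)"
    "\<And>t. t \<in> {-1<..<1} \<Longrightarrow> (u' has_real_derivative - ultraspherical_F n \<alpha> t * u t) (at t)"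
proof -
  obtain P' P'' where P: "\<And>t. (ultraspherical n \<alpha> has_real_derivative P' t) (at t)"
    "\<And>t. (P' has_real_derivative P'' t) (at t)"
    "\<And>t. (1 - t^2) * P'' t - (2 * \<alpha> + 2) * t * P' t
        + real n * (real n + 2 * \<alpha> + 1) * ultraspherical n \<alpha> t = 0"
    using ultraspherical_ode[of n \<alpha>] by blast
  define r where "r t = (1 - t^2) powr ((\<alpha> + 1) / 2)" for t :: real
  define h where "h t = (\<alpha> + 1) * t / (1 - t^2)" for t :: real
  have s: "0 < 1 - t^2" if "t \<in> {-1<..<1}" for t :: real
    using that by (simp add: abs_square_less_1 abs_less_iff)
  have dr: "(r has_real_derivative - h t * r t) (at t)" if "t \<in> {-1<..<1}" for t
  proof -
    have "(1 - t^2) powr ((\<alpha> + 1) / 2 - 1) = r t / (1 - t^2)"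
      using s[OF that] powr_diff[of "1 - t^2" "(\<alpha> + 1) / 2" 1] by (simp add: r_def)
    then have "((\<alpha> + 1) / 2 * (1 - t^2) powr ((\<alpha> + 1) / 2 - 1)) * (- 2 * t) = - h t * r t"
      by (simp only: h_def) (use s[OF that] in \<open>simp add: field_simps\<close>)
    moreover have "(r has_real_derivative ((\<alpha> + 1) / 2 * (1 - t^2) powr ((\<alpha> + 1) / 2 - 1)) * (- 2 * t)) (at t)"
      unfolding r_def
      by (rule DERIV_chain2[where g = "\<lambda>t. 1 - t^2", OF has_real_derivative_powr[OF s[OF that]]])
        (auto intro!: derivative_eq_intros)
    ultimately show ?thesis by simp
  qed
  have dh: "(h has_real_derivative (\<alpha> + 1) * (1 + t^2) / (1 - t^2)^2) (at t)" if "t \<in> {-1<..<1}" for t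
    unfolding h_def using s[OF that]
    by (auto intro!: derivative_eq_intros simp: power2_eq_square field_simps)
  have u: "u = (\<lambda>t. r t * ultraspherical n \<alpha> t)" by (simp add: u_def r_def fun_eq_iff)
  define u' where "u' t = r t * (P' t - h t * ultraspherical n \<alpha> t)" for t
  show ?thesis
  proof (rule that)
    fix t :: real assume t: "t \<in> {-1<..<1}"
    show "(u has_real_derivative u' t) (at t)"
      unfolding u u'_def by (auto intro!: derivative_eq_intros dr[OF t] P simp: algebra_simps)
    have "(u' has_real_derivative r t * (P'' t - ((\<alpha> + 1) * (1 + t^2) / (1 - t^2)^2 * ultraspherical n \<alpha> t
        + h t * P' t) - h t * (P' t - h t * ultraspherical n \<alpha> t))) (at t)"
      unfolding u'_def[abs_def]
      by (auto intro!: derivative_eq_intros dr[OF t] dh[OF t] P(1,2) simp: algebra_simps)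
    moreover have "P'' t - ((\<alpha> + 1) * (1 + t^2) / (1 - t^2)^2 * ultraspherical n \<alpha> t
        + h t * P' t) - h t * (P' t - h t * ultraspherical n \<alpha> t)
      = - ultraspherical_F n \<alpha> t * ultraspherical n \<alpha> t"
    proof -
      define S where "S = 1 - t^2"
      have "S \<noteq> 0" using s[OF t] by (simp add: S_def)
      have t2: "t * t = 1 - S" by (simp add: S_def power2_eq_square)
      have P'': "P'' t = ((2 * \<alpha> + 2) * t * P' t - real n * (real n + 2 * \<alpha> + 1) * ultraspherical n \<alpha> t) / S"
        using P(3)[of t] \<open>S \<noteq> 0\<close> by (simp add: S_def field_simps)
      show ?thesis
        unfolding P'' h_def ultraspherical_F_eq[OF t] S_def[symmetric] power2_eq_square[of t] t2
        using \<open>S \<noteq> 0\<close> t2 by (simp add: divide_simps) algebra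
    qed
    ultimately show "(u' has_real_derivative - ultraspherical_F n \<alpha> t * u t) (at t)"
      by (simp add: u ac_simps)
  qed
qed

text \<open>
  In terms of \<open>x = 1 / (1 - s\<^sup>2)\<close> and \<open>y = 1 / (1 - t\<^sup>2)\<close>, the difference of the two values is
  \<open>(A - B (x + y)) (y - x)\<close>. Because \<open>1 \<le> x < y\<close>, the first factor is less than
  \<open>A - 2 B \<le> 0\<close>.
\<close>

lemma ultraspherical_F_decreasing:
  assumes "1 < \<bar>\<alpha>\<bar>" and "(real n + \<alpha>) * (real n + \<alpha> + 1) \<le> 2 * (\<alpha>^2 - 1)"
    and "\<bar>s\<bar> < \<bar>t\<bar>" "\<bar>t\<bar> < 1"
  shows "ultraspherical_F n \<alpha> t < ultraspherical_F n \<alpha> s"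
proof -
  define A B where "A = (real n + \<alpha>) * (real n + \<alpha> + 1)" and "B = \<alpha>^2 - 1"
  define x y where "x = inverse (1 - s^2)" and "y = inverse (1 - t^2)"
  have B: "0 < B" "A \<le> 2 * B" using assms(1,2) one_less_power[of "\<bar>\<alpha>\<bar>" 2] by (auto simp: A_def B_def)
  have "0 \<le> s^2" "s^2 < t^2" "t^2 < 1"
    using assms(3,4) by (auto simp: abs_square_less_1 power2_strict_mono)
  then have "1 \<le> x" "x < y" by (auto simp: x_def y_def one_le_inverse_iff)
  have "B * 2 < B * (x + y)"
    using B \<open>1 \<le> x\<close> \<open>x < y\<close> by (intro mult_strict_left_mono) auto
  then have "(A - B * (x + y)) * (y - x) < 0"
    using B(2) \<open>x < y\<close> by (intro mult_neg_pos; linarith)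
  then have "A * y - B * y^2 < A * x - B * x^2" by (simp add: algebra_simps power2_eq_square)
  moreover have "s \<in> {-1<..<1}" "t \<in> {-1<..<1}" using assms(3,4) by auto
  ultimately show ?thesis
    by (simp add: ultraspherical_F_eq A_def B_def x_def y_def divide_inverse power_inverse)
qed

theorem theorem5p2:
  fixes n :: nat and \<alpha> :: real
  assumes "n > 0"
    and "real n + \<alpha> > 0"
    and "real n + 2 * \<alpha> > 0"
    and "\<bar>\<alpha>\<bar> > 1"
    and "(real n + \<alpha>) * (real n + \<alpha> + 1) \<le> 2 * (\<alpha> ^ 2 - 1)"
  shows "concave_zeros_on (ultraspherical n \<alpha>) {-1<..<0} \<and>
         convex_zeros_on (ultraspherical n \<alpha>) {0<..<1} \<and>
         (\<forall>x y. consecutive_zeros (ultraspherical n \<alpha>) {-1<..<1} x y \<longrightarrow>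
            y - x > pi / sqrt (ultraspherical_F n \<alpha> 0))"
proof -
  define u where "u = (\<lambda>t. (1 - t^2) powr ((\<alpha> + 1) / 2) * ultraspherical n \<alpha> t)"
  let ?F = "ultraspherical_F n \<alpha>"
  obtain u' where u: "\<And>t. t \<in> {-1<..<1} \<Longrightarrow> (u has_real_derivative u' t) (at t)"
    "\<And>t. t \<in> {-1<..<1} \<Longrightarrow> (u' has_real_derivative - ?F t * u t) (at t)"
    using ultraspherical_normal_form[where n = n and \<alpha> = \<alpha>] unfolding u_def by blast
  have u_zero: "u t = 0 \<longleftrightarrow> ultraspherical n \<alpha> t = 0" if "-1 < t" "t < 1" for t
    using that abs_square_less_1[of t] by (auto simp: u_def)
  have zeros: "consecutive_zeros u {c<..<d} x y \<longleftrightarrow> consecutive_zeros (ultraspherical n \<alpha>) {c<..<d} x y"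
    if "-1 \<le> c" "d \<le> 1" for c d x y
    using that by (auto simp: consecutive_zeros_def u_zero)
  note dec = ultraspherical_F_decreasing[OF assms(4,5)]
  have "concave_zeros_on u {-1<..<0}"
    by (rule concave_zeros_if_coefficient_increasing[where u' = u' and F = ?F]) (use u dec in auto)
  moreover have "convex_zeros_on u {0<..<1}"
    by (rule convex_zeros_if_coefficient_decreasing[where u' = u' and F = ?F]) (use u dec in auto)
  moreover have "y - x > pi / sqrt (?F 0)" if "consecutive_zeros u {-1<..<1} x y" for x y
  proof (rule gap_gt_if_coefficient_bounded[OF u _ _ _ that])
    show "?F t \<le> ?F 0" if "t \<in> {-1<..<1}" for t
      using dec[of 0 t] that by (cases "t = 0") (auto simp: abs_less_iff)
    show "\<exists>t\<in>{a<..<b}. ?F t < ?F 0" if "-1 < a" "a < b" "b < 1" for a b :: real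
    proof -
      obtain t where "a < t" "t < b" "t \<noteq> 0"
        using \<open>a < b\<close> by (metis dense less_irrefl less_trans)
      then show ?thesis using that by (intro bexI[of _ t] dec) auto
    qed
    have "?F 0 = real n * (real n + 2 * \<alpha>) + (real n + \<alpha>) + 1"
      by (simp add: ultraspherical_F_def algebra_simps power2_eq_square)
    then show "0 < ?F 0" using assms(1-3) by (simp add: add_pos_pos)
  qed
  ultimately show ?thesis
    by (simp add: zeros concave_zeros_on_def convex_zeros_on_def)
qed

end
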